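(* Let $X$ be a discrete memoryless source with finite alphabet $\mathcal{X}$ and entropy $H(X)$, and let $0\le\epsilon<H(X)$. Let $(\mathcal{C}_n)$ be a sequence of list-source codes for $X$ that achieves a rate-list pair $(R,L)$ and has $\epsilon$-symbol secrecy $\mu_\epsilon$. Then $$0\ \le\ \mu_\epsilon\ \le\ \min\left\{\frac{L\log|\mathcal{X}|}{H(X)-\epsilon},\,1\right\}.$$
   Context: All logarithms, entropies and mutual informations are in base 2, $|\mathcal{X}|\ge 2$, and $X^n=(X_1,\dots,X_n)$ is a vector of i.i.d. copies of $X$. A $(2^{nR},|\mathcal{X}|^{nL},n)$-list-source code (with $2^{nR}$ and $|\mathcal{X}|^{nL}$ positive integers, $0\le L\le 1$) consists of $f_n:\mathcal{X}^n\to\{1,\dots,2^{nR}\}$ and $g_n:\{1,\dots,2^{nR}\}\to\mathcal{P}(\mathcal{X}^n)\setminus\{\varnothing\}$ with $|g_n(w)|=|\mathcal{X}|^{nL}$ for all $w$. Its error probability is $e_L(f_n,g_n)=\Pr(X^n\notin g_n(f_n(X^n)))$. A sequence $\mathcal{C}_n=(f_n,g_n)$ of $(2^{nR_n},|\mathcal{X}|^{nL_n},n)$-list-source codes achieves $(R,L)$ if for every $\delta>0$ and $0<\epsilon'<1$, for all sufficiently large $n$: $R_n<R+\delta$, $|L_n-L|<\delta$ and $e_{L_n}(f_n,g_n)\le\epsilon'$. Write $Y^{nR_n}=f_n(X^n)$ for the codeword. Let $\mathcal{I}_n(t)$ be the set of all $t$-element subsets of $\{1,\dots,n\}$, and for $\mathcal{J}\subseteq\{1,\dots,n\}$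 let $X^{(\mathcal{J})}=(X_i)_{i\in\mathcal{J}}$. The $\epsilon$-symbol secrecy of a single code is $$\mu_\epsilon(\mathcal{C}_n)=\max\left\{\frac{t}{n}:\ \frac{1}{t}I(X^{(\mathcal{J})};Y^{nR_n})\le\epsilon\ \ \forall\,\mathcal{J}\in\mathcal{I}_n(t)\right\},$$ where $t$ ranges over $\{0,1,\dots,n\}$ and the condition is considered satisfied for $t=0$. The $\epsilon$-symbol secrecy of the sequence is $\mu_\epsilon=\liminf_{n\to\infty}\mu_\epsilon(\mathcal{C}_n)$. *)

theory Defs
  imports "HOL-Probability.Probability"
begin

abbreviation shannon_entropy :: "'w measure \<Rightarrow> ('w \<Rightarrow> 'b) \<Rightarrow> real" where
  "shannon_entropy M U \<equiv> prob_space.entropy M 2 (count_space (U ` space M)) U"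

abbreviation shannon_mutual_information ::
    "'w measure \<Rightarrow> ('w \<Rightarrow> 'b) \<Rightarrow> ('w \<Rightarrow> 'c) \<Rightarrow> real" where
  "shannon_mutual_information M U V \<equiv>
     prob_space.mutual_information M 2 (count_space (U ` space M)) (count_space (V ` space M)) U V"

text \<open>The source letters are indexed from 1; \<open>X 0\<close> plays no role. The alphabet is the
  type \<open>'a\<close>; letters of probability zero are allowed.\<close>

definition discrete_memoryless_source ::
    "'w measure \<Rightarrow> (nat \<Rightarrow> 'w \<Rightarrow> 'a::finite) \<Rightarrow> bool" where
  "discrete_memoryless_source M X \<longleftrightarrow>
     prob_space M \<and>
     prob_space.indep_vars M (\<lambda>_. count_space UNIV) X {1..} \<and>
     (\<forall>i\<ge>1. distr M (count_space UNIV) (X i) = distr M (count_space UNIV) (X 1))"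

text \<open>\<open>subvector X J\<close> is the random vector $X^{(\mathcal{J})}$; the source block $X^n$ is
  \<open>subvector X {1..n}\<close>, with values in \<open>words n\<close>.\<close>

definition subvector :: "(nat \<Rightarrow> 'w \<Rightarrow> 'a) \<Rightarrow> nat set \<Rightarrow> 'w \<Rightarrow> nat \<Rightarrow> 'a" where
  "subvector X J \<omega> = (\<lambda>i\<in>J. X i \<omega>)"

definition words :: "nat \<Rightarrow> (nat \<Rightarrow> 'a) set" where
  "words n = {1..n} \<rightarrow>\<^sub>E UNIV"

text \<open>Under the requirement \<open>2 powr (n * R) \<in> \<nat>\<close> of \<open>list_source_code\<close> below, this is
  $\{1,\dots,2^{nR}\}$.\<close>

definition codewords :: "nat \<Rightarrow> real \<Rightarrow> nat set" where
  "codewords n R = {w. 1 \<le> w \<and> real w \<le> 2 powr (real n * R)}"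

definition list_source_code ::
    "nat \<Rightarrow> real \<Rightarrow> real \<Rightarrow> ((nat \<Rightarrow> 'a::finite) \<Rightarrow> nat) \<Rightarrow> (nat \<Rightarrow> (nat \<Rightarrow> 'a) set) \<Rightarrow> bool" where
  "list_source_code n R L f g \<longleftrightarrow>
     0 \<le> L \<and> L \<le> 1 \<and>
     2 powr (real n * R) \<in> \<nat> \<and>
     real CARD('a) powr (real n * L) \<in> \<nat> \<and>
     f \<in> words n \<rightarrow> codewords n R \<and>
     (\<forall>w\<in>codewords n R. g w \<subseteq> words n \<and> g w \<noteq> {} \<and>
        real (card (g w)) = real CARD('a) powr (real n * L))"

definition error_probability ::
    "'w measure \<Rightarrow> (nat \<Rightarrow> 'w \<Rightarrow> 'a) \<Rightarrow> nat \<Rightarrow> ((nat \<Rightarrow> 'a) \<Rightarrow> nat) \<Rightarrow> (nat \<Rightarrow> (nat \<Rightarrow> 'a) set) \<Rightarrow> real" where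
  "error_probability M X n f g =
     measure M {\<omega> \<in> space M. subvector X {1..n} \<omega> \<notin> g (f (subvector X {1..n} \<omega>))}"

definition achieves ::
    "'w measure \<Rightarrow> (nat \<Rightarrow> 'w \<Rightarrow> 'a) \<Rightarrow> (nat \<Rightarrow> real) \<Rightarrow> (nat \<Rightarrow> real) \<Rightarrow>
     (nat \<Rightarrow> (nat \<Rightarrow> 'a) \<Rightarrow> nat) \<Rightarrow> (nat \<Rightarrow> nat \<Rightarrow> (nat \<Rightarrow> 'a) set) \<Rightarrow> real \<Rightarrow> real \<Rightarrow> bool" where
  "achieves M X Rs Ls f g R L \<longleftrightarrow>
     (\<forall>\<delta>>0. \<forall>\<epsilon>'. 0 < \<epsilon>' \<and> \<epsilon>' < 1 \<longrightarrow>
        (\<forall>\<^sub>F n in sequentially.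
           Rs n < R + \<delta> \<and> \<bar>Ls n - L\<bar> < \<delta> \<and> error_probability M X n (f n) (g n) \<le> \<epsilon>'))"

definition code_symbol_secrecy ::
    "'w measure \<Rightarrow> (nat \<Rightarrow> 'w \<Rightarrow> 'a) \<Rightarrow> real \<Rightarrow> nat \<Rightarrow> ((nat \<Rightarrow> 'a) \<Rightarrow> nat) \<Rightarrow> real" where
  "code_symbol_secrecy M X \<epsilon> n f =
     Max {real t / real n |t. t \<le> n \<and>
       (t = 0 \<or> (\<forall>J. J \<subseteq> {1..n} \<and> card J = t \<longrightarrow>
          1 / real t * shannon_mutual_information M (subvector X J)
            (\<lambda>\<omega>. f (subvector X {1..n} \<omega>)) \<le> \<epsilon>))}"

text \<open>The limit inferior is taken in \<open>ereal\<close> because \<^const>\<open>Liminf\<close> needs a complete lattice.\<close>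

definition symbol_secrecy ::
    "'w measure \<Rightarrow> (nat \<Rightarrow> 'w \<Rightarrow> 'a) \<Rightarrow> real \<Rightarrow> (nat \<Rightarrow> (nat \<Rightarrow> 'a) \<Rightarrow> nat) \<Rightarrow> ereal" where
  "symbol_secrecy M X \<epsilon> f = liminf (\<lambda>n. ereal (code_symbol_secrecy M X \<epsilon> n (f n)))"

end

theory Submission
  imports Defs
begin

text \<open>If every \<open>t\<close>-subset \<open>J\<close> leaks at most \<open>t \<epsilon>\<close> bits, then
  \<open>t (H(X) - \<epsilon>) \<le> H(X\<^sup>J | Y) \<le> H(X\<^sup>n | Y)\<close>, where \<open>Y\<close> is the codeword. A list version of Fano's
  inequality bounds the right-hand side by \<open>1 + n (L\<^sub>n + e\<^sub>n) log |\<X>|\<close>, with \<open>e\<^sub>n\<close> the error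
  probability. Dividing by \<open>n\<close> and letting \<open>n\<close> tend to infinity gives the bound.\<close>

section \<open>Gibbs' inequality for finite sums\<close>

text \<open>Termwise this is \<open>ln z\<close> \<le> \<open>z - 1\<close> at
  \<open>z = q x / p x\<close>; summation leaves \<open>sum q A - sum p A\<close>, which is at most
  zero. The weights \<open>q\<close> may have less mass than \<open>p\<close>, as happens in the
  Fano argument.\<close>

lemma gibbs_inequality:
  fixes p q :: "'a \<Rightarrow> real"
  assumes "finite A" "1 < b"
    and p: "\<And>x. x \<in> A \<Longrightarrow> 0 \<le> p x" and q: "\<And>x. x \<in> A \<Longrightarrow> 0 \<le> q x"
    and pos: "\<And>x. x \<in> A \<Longrightarrow> 0 < p x \<Longrightarrow> 0 < q x"
    and le: "sum q A \<le> sum p A"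
  shows "(\<Sum>x\<in>A. p x * log b (q x)) \<le> (\<Sum>x\<in>A. p x * log b (p x))"
proof -
  have "p x * log b (q x) - p x * log b (p x) \<le> (q x - p x) / ln b" if x: "x \<in> A" for x
  proof (cases "p x = 0")
    case True
    then show ?thesis using q[OF x] \<open>1 < b\<close> by simp
  next
    case False
    with p[OF x] have px: "0 < p x" by simp
    have qx: "0 < q x" using pos[OF x px] .
    have "ln (q x / p x) \<le> q x / p x - 1" using px qx by (intro ln_le_minus_one) simp
    then have "p x * ln (q x / p x) \<le> p x * (q x / p x - 1)" using px by simp
    also have "\<dots> = q x - p x" using px by (simp add: field_simps)
    finally have "p x * (ln (q x) - ln (p x)) / ln b \<le> (q x - p x) / ln b"
      using px qx \<open>1 < b\<close> by (simp add: ln_div divide_right_mono)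
    then show ?thesis by (simp add: log_def algebra_simps diff_divide_distrib)
  qed
  then have "(\<Sum>x\<in>A. p x * log b (q x) - p x * log b (p x)) \<le> (\<Sum>x\<in>A. (q x - p x) / ln b)"
    by (rule sum_mono)
  also have "\<dots> = (sum q A - sum p A) / ln b"
    by (simp add: sum_subtractf flip: sum_divide_distrib)
  also have "\<dots> \<le> 0" using le \<open>1 < b\<close> by (simp add: divide_nonpos_pos)
  finally show ?thesis by (simp add: sum_subtractf)
qed

section \<open>Entropy and mutual information as finite sums\<close>

lemma (in prob_space) prob_eq_sum_preimage:
  assumes "simple_function M U"
  shows "prob {\<omega> \<in> space M. P (U \<omega>)} = (\<Sum>u\<in>{u \<in> U ` space M. P u}. prob (U -` {u} \<inter> space M))"
proof -
  have fin: "finite (U ` space M)" using assms by (rule simple_functionD)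
  have "(\<Sum>u\<in>{u \<in> U ` space M. P u}. prob (U -` {u} \<inter> space M))
      = prob (\<Union>u\<in>{u \<in> U ` space M. P u}. U -` {u} \<inter> space M)"
    using fin simple_functionD(2)[OF assms]
    by (intro finite_measure_finite_Union[symmetric]) (auto simp: disjoint_family_on_def)
  also have "(\<Union>u\<in>{u \<in> U ` space M. P u}. U -` {u} \<inter> space M) = {\<omega> \<in> space M. P (U \<omega>)}"
    by auto
  finally show ?thesis by simp
qed

text \<open>A value that is never attained has an empty preimage, so its term vanishes. Variables
  with different ranges can thus be compared over one common index set.\<close>

lemma (in information_space) entropy_eq_sum_superset:
  assumes "simple_function M U" "U ` space M \<subseteq> A" "finite A"
  shows "\<H>(U) = - (\<Sum>u\<in>A. prob (U -` {u} \<inter> space M) * log b (prob (U -` {u} \<inter> space M)))"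
proof -
  have "\<H>(U) = - (\<Sum>u\<in>U ` space M. prob (U -` {u} \<inter> space M) * log b (prob (U -` {u} \<inter> space M)))"
    by (rule entropy_simple_distributed[OF simple_distributedI[OF assms(1) measure_nonneg refl]])
  also have "(\<Sum>u\<in>U ` space M. prob (U -` {u} \<inter> space M) * log b (prob (U -` {u} \<inter> space M)))
      = (\<Sum>u\<in>A. prob (U -` {u} \<inter> space M) * log b (prob (U -` {u} \<inter> space M)))"
  proof (rule sum.mono_neutral_left)
    show "\<forall>u\<in>A - U ` space M. prob (U -` {u} \<inter> space M) * log b (prob (U -` {u} \<inter> space M)) = 0"
    proof
      fix u assume "u \<in> A - U ` space M"
      then have "U -` {u} \<inter> space M = {}" by auto
      then show "prob (U -` {u} \<inter> space M) * log b (prob (U -` {u} \<inter> space M)) = 0"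
        by (metis measure_empty mult_zero_left)
    qed
  qed (use assms in auto)
  finally show ?thesis .
qed

text \<open>Eliminates H(U|V) between I(U;V) = H(U) - H(U|V) and the chain rule for the pair (V,U);
  hence the order inside the pair.\<close>

lemma (in information_space) mutual_information_eq_entropies:
  assumes "simple_function M U" "simple_function M V"
  shows "\<I>(U ; V) = \<H>(U) + \<H>(V) - \<H>(\<lambda>\<omega>. (V \<omega>, U \<omega>))"
  using mutual_information_eq_entropy_conditional_entropy[OF assms]
    entropy_chain_rule[OF assms(2,1)] by simp

section \<open>Fano's inequality for lists\<close>

text \<open>The left-hand side is H(U | f(U)), because f(U) is a function of U. Gibbs' inequality
  bounds it by the expected code length - log r(U) of a guess \<open>r\<close> made from the
  codeword: one factor 2 for splitting the mass, then K on the list and |A| off it.\<close>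

lemma (in information_space) list_fano_inequality:
  assumes U: "simple_function M U" and A: "U ` space M \<subseteq> A" "finite A"
    and g: "\<And>u. u \<in> A \<Longrightarrow> finite (g (f u))" "\<And>u. u \<in> A \<Longrightarrow> card (g (f u)) \<le> K" and K: "1 \<le> K"
  shows "\<H>(U) - \<H>(f \<circ> U)
    \<le> log b 2 + log b K + prob {\<omega> \<in> space M. U \<omega> \<notin> g (f (U \<omega>))} * log b (card A)"
proof -
  define S where "S = U ` space M"
  define p where "p u = prob (U -` {u} \<inter> space M)" for u
  define pY where "pY y = prob ((f \<circ> U) -` {y} \<inter> space M)" for y
  \<comment> \<open>Given the codeword, half of the mass is spread uniformly over its list and half over
    all values.\<close>
  define r where "r u = (if u \<in> g (f u) then 1 / (2 * real K) else 1 / (2 * real (card A)))" for u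
  have fS: "finite S" using U unfolding S_def by (rule simple_functionD)
  have SA: "S \<subseteq> A" using A(1) by (simp add: S_def)
  have "space M \<noteq> {}" by (rule not_empty)
  then have "A \<noteq> {}" using A(1) by auto
  then have N: "1 \<le> card A" using A(2) by (simp add: Suc_le_eq card_gt_0_iff)
  have r_pos: "0 < r u" for u using K N by (simp add: r_def)
  have p_nn: "0 \<le> p u" and pY_nn: "0 \<le> pY y" for u y by (simp_all add: p_def pY_def)
  have pY_eq: "pY y = (\<Sum>u\<in>{u \<in> S. f u = y}. p u)" for y
  proof -
    have "(f \<circ> U) -` {y} \<inter> space M = {\<omega> \<in> space M. f (U \<omega>) = y}" by auto
    then show ?thesis
      using prob_eq_sum_preimage[OF U, of "\<lambda>u. f u = y"] by (simp add: pY_def p_def S_def)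
  qed
  have p_le: "p u \<le> pY (f u)" if "u \<in> S" for u
    unfolding pY_eq using that fS p_nn by (intro member_le_sum) auto
  have p_sum: "sum p S = 1"
    using prob_eq_sum_preimage[OF U, of "\<lambda>_. True"] by (simp add: p_def S_def prob_space)
  have group: "(\<Sum>y\<in>f ` S. \<Sum>u\<in>{u \<in> S. f u = y}. h u) = sum h S" for h :: "_ \<Rightarrow> real"
    using fS by (intro sum.group) auto
  have pY_sum: "sum pY (f ` S) = 1"
    using group[of p] by (simp add: pY_eq p_sum)
  \<comment> \<open>Within one fibre of \<open>f\<close>, at most K values lie on the list and at
    most |A| off it, so each kind carries at most half a unit. Equality can fail because the list
    may contain values outside the fibre.\<close>
  have list_mass: "(\<Sum>u\<in>{u \<in> S. f u = y}. r u) \<le> 1" if y: "y \<in> f ` S" for y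
  proof -
    let ?B = "{u \<in> S. f u = y}"
    from y obtain u0 where u0: "u0 \<in> S" "y = f u0" by auto
    with g SA have gy: "finite (g y)" "card (g y) \<le> K" by auto
    have "(\<Sum>u\<in>?B. r u) = (\<Sum>u\<in>?B. if u \<in> g y then 1 / (2 * real K) else 1 / (2 * real (card A)))"
      by (intro sum.cong) (auto simp: r_def)
    also have "\<dots> = real (card (?B \<inter> g y)) / (2 * real K)
        + real (card (?B \<inter> - g y)) / (2 * real (card A))"
      using fS by (simp add: sum.If_cases)
    also have "\<dots> \<le> 1 / 2 + 1 / 2"
    proof (rule add_mono)
      have "card (?B \<inter> g y) \<le> card (g y)" using gy by (intro card_mono) auto
      then show "real (card (?B \<inter> g y)) / (2 * real K) \<le> 1 / 2"
        using gy K by (simp add: field_simps)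
      have "card (?B \<inter> - g y) \<le> card A" using SA A(2) by (intro card_mono) auto
      then show "real (card (?B \<inter> - g y)) / (2 * real (card A)) \<le> 1 / 2"
        using N by (simp add: field_simps)
    qed
    finally show ?thesis by simp
  qed
  have "(\<Sum>u\<in>S. pY (f u) * r u) = (\<Sum>y\<in>f ` S. \<Sum>u\<in>{u \<in> S. f u = y}. pY (f u) * r u)"
    by (rule group[symmetric])
  also have "\<dots> = (\<Sum>y\<in>f ` S. pY y * (\<Sum>u\<in>{u \<in> S. f u = y}. r u))"
    by (simp add: sum_distrib_left)
  also have "\<dots> \<le> (\<Sum>y\<in>f ` S. pY y * 1)"
    using list_mass pY_nn by (intro sum_mono mult_left_mono) auto
  finally have mass: "(\<Sum>u\<in>S. pY (f u) * r u) \<le> sum p S" by (simp add: pY_sum p_sum)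
  \<comment> \<open>The comparison weights are the true codeword law times the guess
    \<open>r\<close>. They are positive wherever \<open>p\<close> is, since a codeword is at least
    as likely as each value mapped to it.\<close>
  have gibbs: "(\<Sum>u\<in>S. p u * log b (pY (f u) * r u)) \<le> (\<Sum>u\<in>S. p u * log b (p u))"
  proof (rule gibbs_inequality[OF fS b_gt_1 p_nn _ _ mass])
    show "0 \<le> pY (f u) * r u" for u using pY_nn[of "f u"] r_pos[of u] by simp
    show "0 < pY (f u) * r u" if "u \<in> S" "0 < p u" for u
      using p_le[OF that(1)] that(2) r_pos[of u] by simp
  qed
  \<comment> \<open>If \<open>p u = 0\<close>, then \<open>pY (f u)\<close> may vanish and the
    logarithm need not split, but the factor \<open>p u\<close> annihilates both sides.\<close>
  have "p u * log b (pY (f u) * r u) = p u * log b (pY (f u)) + p u * log b (r u)"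
    if u: "u \<in> S" for u
  proof (cases "p u = 0")
    case False
    then have "0 < p u" using p_nn[of u] by simp
    then have "0 < pY (f u)" using p_le[OF u] by linarith
    then have "log b (pY (f u) * r u) = log b (pY (f u)) + log b (r u)"
      using r_pos by (intro log_mult_pos) auto
    then show ?thesis by (simp add: algebra_simps)
  qed simp
  then have split: "(\<Sum>u\<in>S. p u * log b (pY (f u) * r u))
      = (\<Sum>u\<in>S. p u * log b (pY (f u))) + (\<Sum>u\<in>S. p u * log b (r u))"
    by (simp add: sum.distrib)
  have HU: "\<H>(U) = - (\<Sum>u\<in>S. p u * log b (p u))"
    unfolding p_def by (rule entropy_eq_sum_superset) (use U fS S_def in auto)
  have fU: "simple_function M (f \<circ> U)" using U by (rule simple_function_compose)
  have "\<H>(f \<circ> U) = - (\<Sum>y\<in>f ` S. pY y * log b (pY y))"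
    unfolding pY_def by (rule entropy_eq_sum_superset) (use fU fS S_def in auto)
  also have "(\<Sum>y\<in>f ` S. pY y * log b (pY y))
      = (\<Sum>y\<in>f ` S. \<Sum>u\<in>{u \<in> S. f u = y}. p u * log b (pY (f u)))"
    by (intro sum.cong refl) (subst pY_eq, simp add: sum_distrib_right)
  also have "\<dots> = (\<Sum>u\<in>S. p u * log b (pY (f u)))" by (rule group)
  finally have HY: "\<H>(f \<circ> U) = - (\<Sum>u\<in>S. p u * log b (pY (f u)))" .
  \<comment> \<open>The charge \<open>log b 2 + log b K\<close> is levied on every value, so that it
    sums against total mass one. Off the list its part \<open>log b K\<close> is nonnegative
    slack.\<close>
  have "- (p u * log b (r u))
      \<le> p u * (log b 2 + log b K) + (if u \<notin> g (f u) then p u * log b (card A) else 0)" for u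
  proof (cases "u \<in> g (f u)")
    case True
    then have "log b (r u) = - (log b 2 + log b K)"
      using K b_gt_1 by (simp add: r_def log_divide log_mult)
    then have "p u * log b (r u) = - (p u * (log b 2 + log b K))"
      by (simp only: mult_minus_right)
    then show ?thesis using True by simp
  next
    case False
    then have "log b (r u) = - (log b 2 + log b (card A))"
      using N b_gt_1 by (simp add: r_def log_divide log_mult)
    then have "p u * log b (r u) = - (p u * (log b 2 + log b (card A)))"
      by (simp only: mult_minus_right)
    moreover have "0 \<le> p u * log b K" using K b_gt_1 p_nn by simp
    ultimately show ?thesis using False by (simp add: distrib_left)
  qed
  then have "(\<Sum>u\<in>S. - (p u * log b (r u)))
      \<le> (\<Sum>u\<in>S. p u * (log b 2 + log b K) + (if u \<notin> g (f u) then p u * log b (card A) else 0))"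
    by (intro sum_mono)
  also have "\<dots> = sum p S * (log b 2 + log b K)
      + (\<Sum>u\<in>{u \<in> S. u \<notin> g (f u)}. p u) * log b (card A)"
    by (simp only: sum.distrib sum_distrib_right) (simp only: sum.inter_filter[OF fS])
  also have "(\<Sum>u\<in>{u \<in> S. u \<notin> g (f u)}. p u) = prob {\<omega> \<in> space M. U \<omega> \<notin> g (f (U \<omega>))}"
    using prob_eq_sum_preimage[OF U, of "\<lambda>u. u \<notin> g (f u)"] by (simp add: p_def S_def)
  finally have "- (\<Sum>u\<in>S. p u * log b (r u))
      \<le> log b 2 + log b K + prob {\<omega> \<in> space M. U \<omega> \<notin> g (f (U \<omega>))} * log b (card A)"
    by (simp add: p_sum sum_negf)
  then show ?thesis using gibbs split HU HY by linarith
qed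

section \<open>Entropy of a block of independent letters\<close>

lemma (in prob_space) prob_subvector:
  fixes X :: "nat \<Rightarrow> 'a \<Rightarrow> 'b"
  assumes ind: "indep_vars (\<lambda>_. count_space UNIV) X I" and J: "J \<subseteq> I" "finite J"
    and v: "v \<in> extensional J"
  shows "prob (subvector X J -` {v} \<inter> space M) = (\<Prod>i\<in>J. prob (X i -` {v i} \<inter> space M))"
\<comment> \<open>Independence factorises intersections over nonempty index sets only. For empty
  \<open>J\<close> the sole extensional \<open>v\<close> is the constant \<open>undefined\<close>,
  and the event is the whole space.\<close>
proof (cases "J = {}")
  case True
  then have "subvector X J -` {v} \<inter> space M = space M"
    using v by (auto simp: subvector_def)
  then show ?thesis using True by (simp add: prob_space)
next
  case False
  have "subvector X J \<omega> = v \<longleftrightarrow> (\<forall>i\<in>J. X i \<omega> = v i)" for \<omega>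
    using v by (auto simp: subvector_def fun_eq_iff extensional_def)
  then have "subvector X J -` {v} \<inter> space M = (\<Inter>i\<in>J. X i -` {v i} \<inter> space M)"
    using False by auto
  then show ?thesis
    using indep_varsD[OF ind False J(2,1), of "\<lambda>i. {v i}"] by simp
qed

lemma finite_range_subvector:
  fixes X :: "nat \<Rightarrow> 'w \<Rightarrow> 'a::finite"
  assumes "finite J"
  shows "finite (subvector X J ` S)"
proof (rule finite_subset)
  show "subvector X J ` S \<subseteq> J \<rightarrow>\<^sub>E UNIV" by (auto simp: subvector_def)
  show "finite (J \<rightarrow>\<^sub>E (UNIV :: 'a set))" using assms by (intro finite_PiE) auto
qed

lemma simple_function_subvector:
  fixes X :: "nat \<Rightarrow> 'w \<Rightarrow> 'a::finite"
  assumes "\<And>i. i \<in> J \<Longrightarrow> X i \<in> measurable M (count_space UNIV)" "finite J"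
  shows "simple_function M (subvector X J)"
  unfolding simple_function_def
proof (intro conjI ballI)
  show "finite (subvector X J ` space M)" using assms(2) by (rule finite_range_subvector)
  fix v assume "v \<in> subvector X J ` space M"
  then have v: "v \<in> extensional J" by (auto simp: subvector_def)
  have "subvector X J -` {v} \<inter> space M = {\<omega> \<in> space M. \<forall>i\<in>J. X i \<omega> = v i}"
    using v by (auto simp: subvector_def fun_eq_iff extensional_def)
  also have "\<dots> \<in> sets M"
  proof (intro sets.sets_Collect_finite_All assms(2))
    fix i assume "i \<in> J"
    then have "X i -` {v i} \<inter> space M \<in> sets M" using assms(1) by (auto intro: measurable_sets)
    moreover have "X i -` {v i} \<inter> space M = {\<omega> \<in> space M. X i \<omega> = v i}" by auto
    ultimately show "{\<omega> \<in> space M. X i \<omega> = v i} \<in> sets M" by simp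
  qed
  finally show "subvector X J -` {v} \<inter> space M \<in> sets M" .
qed

lemma simple_function_finite_range:
  fixes X :: "'w \<Rightarrow> 'a::finite"
  assumes "X \<in> measurable M (count_space UNIV)"
  shows "simple_function M X"
  using assms unfolding simple_function_def by (auto intro: measurable_sets)

text \<open>Induction on the block: the new letter is independent of the old block, so their mutual
  information is zero and the joint entropy is the sum.\<close>

lemma (in information_space) entropy_subvector:
  fixes X :: "nat \<Rightarrow> 'a \<Rightarrow> 'b::finite"
  assumes ind: "indep_vars (\<lambda>_. count_space UNIV) X I" and J: "finite J" "J \<subseteq> I"
  shows "\<H>(subvector X J) = (\<Sum>i\<in>J. \<H>(X i))"
  using J
proof (induction J rule: finite_induct)
  case empty
  have sf: "simple_function M (subvector X {})"
    by (rule simple_function_subvector) auto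
  \<comment> \<open>The empty block takes a single value with probability one, which contributes 1 *
    log 1 = 0.\<close>
  have "\<H>(subvector X {}) = - (\<Sum>u\<in>{\<lambda>_. undefined}.
      prob (subvector X {} -` {u} \<inter> space M) * log b (prob (subvector X {} -` {u} \<inter> space M)))"
    by (rule entropy_eq_sum_superset[OF sf]) (auto simp: subvector_def)
  also have "\<dots> = 0" by (simp add: prob_subvector[OF ind])
  finally show ?case by simp
next
  case (insert j J)
  have jJ: "insert j J \<subseteq> I" by fact
  have meas: "X i \<in> measurable M (count_space UNIV)" if "i \<in> I" for i
    using ind that by (simp add: indep_vars_def)
  have sf_j: "simple_function M (X j)"
    using meas jJ by (intro simple_function_finite_range) auto
  have sf_J: "simple_function M (subvector X J)" and
    sf_jJ: "simple_function M (subvector X (insert j J))"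
    using meas jJ insert.hyps by (auto intro!: simple_function_subvector)
  \<comment> \<open>Splitting off coordinate \<open>j\<close> loses nothing on blocks that are
    \<open>undefined\<close> outside \<open>insert j J\<close>, so it preserves entropy.\<close>
  let ?h = "\<lambda>v. (restrict v J, v j)"
  have inj: "inj_on ?h (subvector X (insert j J) ` space M)"
    by (auto simp: inj_on_def subvector_def fun_eq_iff restrict_def split: if_splits)
  have comp: "?h \<circ> subvector X (insert j J) = (\<lambda>\<omega>. (subvector X J \<omega>, X j \<omega>))"
    using insert.hyps by (auto simp: fun_eq_iff subvector_def restrict_def)
  have joint: "\<H>(subvector X (insert j J)) = \<H>(\<lambda>\<omega>. (subvector X J \<omega>, X j \<omega>))"
    using entropy_of_inj[OF sf_jJ inj] by (simp only: comp)
  \<comment> \<open>Independence of the new letter from the old block, checked at attained values: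
    the joint event fixes all of \<open>insert j J\<close>, and its product over letters separates
    into the factor at \<open>j\<close> and the product over \<open>J\<close>.\<close>
  have prod: "prob ((\<lambda>\<omega>. (X j \<omega>, subvector X J \<omega>)) -` {(X j \<omega>, subvector X J \<omega>)} \<inter> space M)
    = prob (X j -` {X j \<omega>} \<inter> space M) * prob (subvector X J -` {subvector X J \<omega>} \<inter> space M)"
    (is "?l = ?r") for \<omega>
  proof -
    have "(subvector X J \<omega>' = subvector X J \<omega> \<and> X j \<omega>' = X j \<omega>)
        \<longleftrightarrow> subvector X (insert j J) \<omega>' = subvector X (insert j J) \<omega>" for \<omega>'
      by (auto simp: subvector_def fun_eq_iff restrict_def)
    then have "?l = prob (subvector X (insert j J) -` {subvector X (insert j J) \<omega>} \<inter> space M)"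
      by (intro arg_cong[where f = prob]) auto
    also have "\<dots> = (\<Prod>i\<in>insert j J. prob (X i -` {X i \<omega>} \<inter> space M))"
      using jJ insert.hyps
      by (subst prob_subvector[OF ind]) (auto simp: subvector_def intro!: prod.cong)
    also have "\<dots> = ?r"
      using jJ insert.hyps
      by (subst prob_subvector[OF ind]) (auto simp: subvector_def intro!: prod.cong)
    finally show ?thesis .
  qed
  have "\<I>(X j ; subvector X J) = 0"
    by (rule mutual_information_eq_0_simple
        [OF simple_distributedI[OF sf_j measure_nonneg refl]
            simple_distributedI[OF sf_J measure_nonneg refl]
            simple_distributedI[OF simple_function_Pair[OF sf_j sf_J] measure_nonneg refl]])
       (simp add: prod)
  then show ?case
    using joint insert jJ mutual_information_eq_entropies[OF sf_j sf_J] by simp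
qed

text \<open>Each entropy refers to the range of its own variable, and these ranges may differ on
  null events. Summed over the whole alphabet, both depend only on the point probabilities.\<close>

lemma (in information_space) entropy_eq_of_distr_eq:
  fixes U V :: "'a \<Rightarrow> 'b::finite"
  assumes U: "U \<in> measurable M (count_space UNIV)" and V: "V \<in> measurable M (count_space UNIV)"
    and eq: "distr M (count_space UNIV) U = distr M (count_space UNIV) V"
  shows "\<H>(U) = \<H>(V)"
proof -
  have "prob (U -` {a} \<inter> space M) = prob (V -` {a} \<inter> space M)" for a
    using arg_cong[OF eq, of "\<lambda>D. measure D {a}"] by (simp add: measure_distr U V)
  then show ?thesis
    using entropy_eq_sum_superset[OF simple_function_finite_range[OF U], of UNIV]
      entropy_eq_sum_superset[OF simple_function_finite_range[OF V], of UNIV] by simp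
qed

section \<open>The bound for a single code\<close>

lemma symbol_secrecy_size_bound:
  fixes X :: "nat \<Rightarrow> 'w \<Rightarrow> 'a::finite"
  assumes src: "discrete_memoryless_source M X"
    and code: "list_source_code n R L f g"
    and J: "J \<subseteq> {1..n}" "J \<noteq> {}"
    and leak: "1 / real (card J) * shannon_mutual_information M (subvector X J)
      (\<lambda>\<omega>. f (subvector X {1..n} \<omega>)) \<le> \<epsilon>"
  shows "real (card J) * (shannon_entropy M (X 1) - \<epsilon>)
    \<le> 1 + real n * (L + error_probability M X n f g) * log 2 (real CARD('a))"
proof -
  interpret prob_space M using src unfolding discrete_memoryless_source_def by blast
  interpret information_space M 2 by standard simp
  have ind: "indep_vars (\<lambda>_. count_space UNIV) X {1..}"
    and iid: "\<And>i. 1 \<le> i \<Longrightarrow> distr M (count_space UNIV) (X i) = distr M (count_space UNIV) (X 1)"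
    using src unfolding discrete_memoryless_source_def by blast+
  have meas: "X i \<in> measurable M (count_space UNIV)" if "1 \<le> i" for i
    using ind that by (simp add: indep_vars_def)
  define U where "U = subvector X {1..n}"
  let ?V = "subvector X J"
  have finJ: "finite J" using J(1) by (rule finite_subset) simp
  have cJ: "0 < card J" using finJ J(2) by (simp add: card_gt_0_iff)
  have sf_U: "simple_function M U"
    unfolding U_def using meas by (intro simple_function_subvector) auto
  have sf_V: "simple_function M ?V"
    using meas J(1) finJ by (intro simple_function_subvector) auto
  have sf_Y: "simple_function M (f \<circ> U)" using sf_U by (rule simple_function_compose)
  have "shannon_entropy M ?V = (\<Sum>i\<in>J. shannon_entropy M (X i))"
    using J(1) finJ by (intro entropy_subvector[OF ind]) auto
  also have "\<dots> = (\<Sum>i\<in>J. shannon_entropy M (X 1))"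
    using J(1) by (intro sum.cong refl entropy_eq_of_distr_eq meas iid order_refl) auto
  finally have HV: "shannon_entropy M ?V = real (card J) * shannon_entropy M (X 1)" by simp
  \<comment> \<open>Codeword and subvector are jointly a function of the source block, because
    \<open>J\<close> lies in \<open>{1..n}\<close>. Data processing then gives H(Y,V) \<le> H(U),
    which is H(V|Y) \<le> H(U|Y) after subtracting H(Y).\<close>
  have "(\<lambda>u. (f u, restrict u J)) \<circ> U = (\<lambda>\<omega>. ((f \<circ> U) \<omega>, ?V \<omega>))"
    using J(1) by (auto simp: U_def subvector_def fun_eq_iff restrict_def)
  then have HVY: "shannon_entropy M (\<lambda>\<omega>. ((f \<circ> U) \<omega>, ?V \<omega>)) \<le> shannon_entropy M U"
    using entropy_data_processing[OF sf_U, of "\<lambda>u. (f u, restrict u J)"] by simp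
  have "shannon_mutual_information M ?V (f \<circ> U) \<le> real (card J) * \<epsilon>"
    using leak cJ by (simp add: U_def comp_def field_simps)
  then have 1: "real (card J) * (shannon_entropy M (X 1) - \<epsilon>) \<le> shannon_entropy M U - shannon_entropy M (f \<circ> U)"
    using mutual_information_eq_entropies[OF sf_V sf_Y] HV HVY by (simp add: algebra_simps)
  let ?N = "real CARD('a)"
  \<comment> \<open>The list size is an integer by definition of the code, and at least 1 because a
    power of a positive base is positive.\<close>
  obtain K where K: "?N powr (real n * L) = real K"
    using code by (auto simp: list_source_code_def Nats_def)
  have "0 < ?N powr (real n * L)" by simp
  then have K1: "1 \<le> K" unfolding K by simp
  have fin_words: "finite (words n :: (nat \<Rightarrow> 'a) set)"
    unfolding words_def by (intro finite_PiE) auto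
  have g: "g (f u) \<subseteq> words n \<and> card (g (f u)) = K" if "u \<in> words n" for u
    using code that K by (auto simp: list_source_code_def Pi_iff)
  have card_words: "card (words n :: (nat \<Rightarrow> 'a) set) = CARD('a) ^ n"
    unfolding words_def by (simp add: card_PiE)
  \<comment> \<open>Fano's inequality is applied with all words of length \<open>n\<close> as value
    set, so that its size is exactly the \<open>n\<close>-th power of the alphabet size.\<close>
  have "shannon_entropy M U - shannon_entropy M (f \<circ> U) \<le> log 2 2 + log 2 K
      + prob {\<omega> \<in> space M. U \<omega> \<notin> g (f (U \<omega>))} * log 2 (card (words n :: (nat \<Rightarrow> 'a) set))"
  proof (rule list_fano_inequality[OF sf_U _ fin_words _ _ K1])
    show "U ` space M \<subseteq> words n" by (auto simp: U_def subvector_def words_def)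
    show "finite (g (f u))" if "u \<in> words n" for u
      using g[OF that] fin_words by (blast intro: finite_subset)
    show "card (g (f u)) \<le> K" if "u \<in> words n" for u using g[OF that] by simp
  qed
  also have "prob {\<omega> \<in> space M. U \<omega> \<notin> g (f (U \<omega>))} = error_probability M X n f g"
    by (simp add: error_probability_def U_def)
  also have "log 2 (real K) = real n * L * log 2 ?N"
    by (simp add: log_powr flip: K)
  also have "log 2 (real (card (words n :: (nat \<Rightarrow> 'a) set))) = real n * log 2 ?N"
    by (simp add: card_words log_nat_power)
  also have "log 2 2 + real n * L * log 2 ?N + error_probability M X n f g * (real n * log 2 ?N)
      = 1 + real n * (L + error_probability M X n f g) * log 2 ?N"
    by (simp add: algebra_simps)
  finally show ?thesis using 1 by linarith
qed

section \<open>Bounds on the maximum defining symbol secrecy\<close>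

text \<open>The candidate \<open>t = 0\<close> is always admissible, so the maximum is over a
  nonempty set; its ratio 0 is covered by \<open>0\<close> \<le> \<open>c\<close>.\<close>

lemma code_symbol_secrecy_le:
  assumes "\<And>t. 1 \<le> t \<Longrightarrow> t \<le> n \<Longrightarrow> (\<And>J. J \<subseteq> {1..n} \<Longrightarrow> card J = t \<Longrightarrow>
      1 / real t * shannon_mutual_information M (subvector X J)
        (\<lambda>\<omega>. f (subvector X {1..n} \<omega>)) \<le> \<epsilon>) \<Longrightarrow> real t / real n \<le> c"
    and "0 \<le> c"
  shows "code_symbol_secrecy M X \<epsilon> n f \<le> c"
  unfolding code_symbol_secrecy_def
proof (rule Max.boundedI, goal_cases)
  case 1
  show ?case
    by (rule finite_subset[of _ "(\<lambda>t. real t / real n) ` {..n}"]) auto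
next
  case 2
  show ?case by blast
next
  case (3 a)
  then obtain t where t: "a = real t / real n" "t \<le> n"
    "t = 0 \<or> (\<forall>J. J \<subseteq> {1..n} \<and> card J = t \<longrightarrow>
      1 / real t * shannon_mutual_information M (subvector X J)
        (\<lambda>\<omega>. f (subvector X {1..n} \<omega>)) \<le> \<epsilon>)" by blast
  then show ?case using assms by (cases "t = 0") auto
qed

lemma code_symbol_secrecy_nonneg: "0 \<le> code_symbol_secrecy M X \<epsilon> n f"
  unfolding code_symbol_secrecy_def
proof (rule Max_ge, goal_cases)
  case 1
  show ?case
    by (rule finite_subset[of _ "(\<lambda>t. real t / real n) ` {..n}"]) auto
next
  case 2
  show ?case by force
qed

section \<open>Passage to the limit\<close>

theorem proposition3:
  fixes M :: "'w measure"
    and X :: "nat \<Rightarrow> 'w \<Rightarrow> 'a::finite"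
    and f :: "nat \<Rightarrow> (nat \<Rightarrow> 'a) \<Rightarrow> nat"
    and g :: "nat \<Rightarrow> nat \<Rightarrow> (nat \<Rightarrow> 'a) set"
    and Rs Ls :: "nat \<Rightarrow> real"
    and R L \<epsilon> :: real
  assumes "CARD('a) \<ge> 2"
    and "discrete_memoryless_source M X"
    and "0 \<le> \<epsilon>" and "\<epsilon> < shannon_entropy M (X 1)"
    and "\<And>n. n \<ge> 1 \<Longrightarrow> list_source_code n (Rs n) (Ls n) (f n) (g n)"
    and "achieves M X Rs Ls f g R L"
  shows "0 \<le> symbol_secrecy M X \<epsilon> f \<and>
         symbol_secrecy M X \<epsilon> f
           \<le> ereal (min (L * log 2 (real CARD('a)) / (shannon_entropy M (X 1) - \<epsilon>)) 1)"
proof -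
  define l where "l = log 2 (real CARD('a))"
  define d where "d = shannon_entropy M (X 1) - \<epsilon>"
  define e where "e n = error_probability M X n (f n) (g n)" for n
  \<comment> \<open>The single-code bound on \<open>t\<close>, divided by \<open>n\<close> and by
    the positive gap \<open>d\<close>.\<close>
  define c where "c n = (1 / real n + (Ls n + e n) * l) / d" for n
  have l: "0 \<le> l" using assms(1) by (simp add: l_def)
  have d: "0 < d" using assms(4) by (simp add: d_def)
  have e0: "0 \<le> e n" for n by (simp add: e_def error_probability_def)
  have Ls0: "0 \<le> Ls n" if "n \<ge> 1" for n using assms(5)[OF that] by (simp add: list_source_code_def)
  have ach: "\<forall>\<^sub>F n in sequentially. \<bar>Ls n - L\<bar> < \<delta> \<and> e n < \<delta>" if "0 < \<delta>" for \<delta> :: real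
  proof -
    \<comment> \<open>The cap 1/2 keeps the error level below 1 for large \<delta>; halving \<delta>
      turns the weak bound on the error into a strict one.\<close>
    have "0 < min (\<delta> / 2) (1 / 2)" "min (\<delta> / 2) (1 / 2) < 1" using that by auto
    then have "\<forall>\<^sub>F n in sequentially. Rs n < R + \<delta> \<and> \<bar>Ls n - L\<bar> < \<delta> \<and> e n \<le> min (\<delta> / 2) (1 / 2)"
      using assms(6) that unfolding achieves_def e_def by blast
    then show ?thesis by eventually_elim (use that in auto)
  qed
  have "Ls \<longlonglongrightarrow> L"
    by (rule tendstoI) (use ach in \<open>force elim: eventually_mono simp: dist_real_def\<close>)
  moreover have "e \<longlonglongrightarrow> 0"
    by (rule tendstoI) (use ach e0 in \<open>force elim: eventually_mono simp: dist_real_def\<close>)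
  ultimately have "c \<longlonglongrightarrow> (0 + (L + 0) * l) / d"
    unfolding c_def using d by (intro tendsto_intros lim_1_over_n) auto
  then have lim_c: "(\<lambda>n. ereal (c n)) \<longlonglongrightarrow> ereal (L * l / d)" by simp
  have le_c: "code_symbol_secrecy M X \<epsilon> n (f n) \<le> c n" if n: "n \<ge> 1" for n
  proof (rule code_symbol_secrecy_le)
    show "0 \<le> c n" using l d e0[of n] Ls0[OF n] by (simp add: c_def)
    fix t assume t: "1 \<le> t" "t \<le> n" and leak: "\<And>J. J \<subseteq> {1..n} \<Longrightarrow> card J = t \<Longrightarrow>
      1 / real t * shannon_mutual_information M (subvector X J)
        (\<lambda>\<omega>. f n (subvector X {1..n} \<omega>)) \<le> \<epsilon>"
    \<comment> \<open>The leakage condition holds for every set of size \<open>t\<close>; the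
      initial segment serves as a concrete one.\<close>
    have J: "{1..t} \<subseteq> {1..n}" "{1..t} \<noteq> {}" using t by auto
    have "real t * d \<le> 1 + real n * (Ls n + e n) * l"
      using symbol_secrecy_size_bound[OF assms(2) assms(5)[OF n] J] leak[OF J(1)]
      by (simp add: d_def e_def l_def)
    then show "real t / real n \<le> c n"
      using n d by (simp add: c_def field_simps)
  qed
  have "0 \<le> symbol_secrecy M X \<epsilon> f"
    unfolding symbol_secrecy_def
    by (rule Liminf_bounded) (simp add: code_symbol_secrecy_nonneg)
  moreover have "symbol_secrecy M X \<epsilon> f \<le> ereal (L * l / d)"
  proof -
    have "symbol_secrecy M X \<epsilon> f \<le> liminf (\<lambda>n. ereal (c n))"
      unfolding symbol_secrecy_def
      \<comment> \<open>The comparison is available from \<open>n = 1\<close> on, which suffices for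
        the limit inferior.\<close>
      by (rule Liminf_mono) (use le_c in \<open>auto intro!: eventually_sequentiallyI[of 1]\<close>)
    also have "\<dots> = ereal (L * l / d)"
      using lim_c by (intro lim_imp_Liminf) auto
    finally show ?thesis .
  qed
  moreover have "symbol_secrecy M X \<epsilon> f \<le> ereal 1"
  proof -
    have "code_symbol_secrecy M X \<epsilon> n (f n) \<le> 1" for n
      by (rule code_symbol_secrecy_le) auto
    then have "symbol_secrecy M X \<epsilon> f \<le> liminf (\<lambda>n. ereal 1)"
      unfolding symbol_secrecy_def by (intro Liminf_mono always_eventually) simp
    then show ?thesis by (simp add: Liminf_const)
  qed
  ultimately show ?thesis by (simp add: l_def d_def)
qed

end
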